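(* Consider the network and the two optimization problems $(\mathrm{L}:\mathcal{SC}(\boldsymbol\xi_i,\boldsymbol s_{\mathcal N_i}),\mathcal F_{\mathcal{AT}}(\mathcal S_i))$ and $(\mathrm{L}:\mathcal{SC}(\boldsymbol\xi_i,\boldsymbol\zeta_{\mathcal N_i}),\mathcal F_{\mathcal{AT}}(\mathcal S_i))$ defined in the context. The problem $(\mathrm{L}:\mathcal{SC}(\boldsymbol\xi_i,\boldsymbol s_{\mathcal N_i}),\mathcal F_{\mathcal{AT}}(\mathcal S_i))$ is equivalent to the problem $(\mathrm{L}:\mathcal{SC}(\boldsymbol\xi_i,\boldsymbol\zeta_{\mathcal N_i}),\mathcal F_{\mathcal{AT}}(\mathcal S_i))$ in the following sense: there exists a mapping between feasible solutions in the former and the latter problem. Moreover, the optimal value of $(\mathrm{L}:\mathcal{SC}(\boldsymbol\xi_i,\boldsymbol s_{\mathcal N_i}),\mathcal F_{\mathcal{AT}}(\mathcal S_i))$ is equal to the optimal value of $(\mathrm{L}:\mathcal{SC}(\boldsymbol\xi_i,\boldsymbol\zeta_{\mathcal N_i}),\mathcal F_{\mathcal{AT}}(\mathcal S_i))$.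
   Context: **Network.** Let $M,T\in\mathbb N$, $\mathcal M=\{1,\dots,M\}$, $\mathcal T=\{1,\dots,T\}$, $\mathcal T_+=\{1,\dots,T+1\}$. Agents $i\in\mathcal M$ are the nodes of a directed graph; $\mathcal N_i\subset\mathcal M$ is the set of agents $j$ with an arc from $j$ to $i$ (the neighbors of $i$). **Notation.** A subscript $\mathcal N_i$ denotes concatenation over $j\in\mathcal N_i$; for a time-dependent vector $\nu_{i,t}$, $\boldsymbol\nu_i^t=(\nu_{i,1},\dots,\nu_{i,t})$ is its history up to time $t$, and $\boldsymbol\nu_{\mathcal N_i}^t=[\boldsymbol\nu_j^t]_{j\in\mathcal N_i}$. $a\preceq_{\mathcal K}b$ is the conic inequality $b-a\in\mathcal K$. **Dynamics, constraints, cost.** Agent $i$ has states $x_{i,t}\in\mathbb R^{n_{x,i}}$ ($t\in\mathcal T_+$, $x_{i,1}$ known), inputs $u_{i,t}\in\mathbb R^{n_{u,i}}$ and disturbances $\xi_{i,t}\in\mathbb R^{n_{\xi,i}}$ ($t\in\mathcal T$). The matrices $A_{i,t},B_{i,t},D_{i,t},E_{i,t}$ are known, of proper dimensions and of full column rank. $\boldsymbol x_i=f_i(\boldsymbol\zeta_{\mathcal N_i},\boldsymbol u_i,\boldsymbol\xi_i)$ means $$x_{i,t+1}=A_{i,t}x_{i,t}+B_{i,t}\boldsymbol\zeta_{\mathcal N_i,t}+D_{i,t}u_{i,t}+E_{i,t}\xi_{i,t},\quad t\in\mathcal T,$$ with $\boldsymbol x_i=[x_{i,t}]_{t\in\mathcal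 T_+}\in\mathbb R^{N_{x,i}}$, $N_{x,i}=(T+1)n_{x,i}$, $\boldsymbol u_i=[u_{i,t}]_{t\in\mathcal T}$, $\boldsymbol\xi_i=[\xi_{i,t}]_{t\in\mathcal T}$; here $\zeta_{j,t}\in\mathbb R^{n_{x,j}}$, $\boldsymbol\zeta_j=[\zeta_{j,t}]_{t\in\mathcal T_+}$, is the belief of agent $i$ about the states of its neighbor $j$. Operational constraints: $\mathcal O_i=\{(\boldsymbol x_i,\boldsymbol u_i): H_{x,i}\boldsymbol x_i+H_{u,i}\boldsymbol u_i\le h_i\}$ with known $H_{x,i},H_{u,i},h_i$. Cost: $J_i(\boldsymbol x_i,\boldsymbol u_i)=\sum_{t=1}^T(\|Q_ix_{i,t}\|_p+\|R_iu_{i,t}\|_p)$ with known $Q_i,R_i$ and $p\in\{1,2,\infty\}$. Disturbances: $\boldsymbol\xi_i\in\Xi_i$, a nonempty, convex, compact polyhedron; the joint uncertainty set of all agents is the product of the $\Xi_i$. **State forecast sets.** For each $i$, let $K_i$ be a given positive integer and let $P_{i,1},\dots,P_{i,K_i}\in\mathbb R^{N_{x,i}\times N_{x,i}}$ be orthogonal projections with $\boldsymbol x_i=\sum_{k=1}^{K_i}P_{i,k}\boldsymbol x_i$. Given matrices $G_{i,k}$, vectors $g_{i,k}$ and convex cones $\mathcal K_{i,k}$, the fixed convex conic set $$\mathcal S_i=\{\boldsymbol s_i\in\mathbb R^{N_{x,i}}: G_{i,k}P_{i,k}\boldsymbol s_i\preceq_{\mathcal K_{i,k}}g_{i,k},\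 k=1,\dots,K_i\}$$ is compact; write $\boldsymbol s_i=[s_{i,t}]_{t\in\mathcal T_+}$. For $y_i\in\mathbb R^{K_i}_+$ (nonnegative entries) and $z_i\in\mathbb R^{N_{x,i}}$, $$\widehat{\mathcal X}_i(y_i,z_i)=\Big\{\boldsymbol x_i:\exists\,\boldsymbol\nu_{i,1},\dots,\boldsymbol\nu_{i,K_i}\in\mathbb R^{N_{x,i}}\text{ s.t. }\boldsymbol x_i=\sum_{k=1}^{K_i}P_{i,k}\boldsymbol\nu_{i,k}+z_i,\ G_{i,k}P_{i,k}\boldsymbol\nu_{i,k}\preceq_{\mathcal K_{i,k}}y_{i,k}g_{i,k},\ k=1,\dots,K_i\Big\},$$ and $\mathcal F_{\mathcal{AT}}(\mathcal S_i)$ is the collection of all such sets. Put $Y_i=\sum_{k=1}^{K_i}y_{i,k}P_{i,k}$, $\widehat{\mathcal X}_{\mathcal N_i}(y_{\mathcal N_i},z_{\mathcal N_i})=\prod_{j\in\mathcal N_i}\widehat{\mathcal X}_j(y_j,z_j)$, $\mathcal S_{\mathcal N_i}=\prod_{j\in\mathcal N_i}\mathcal S_j$, $Y_{\mathcal N_i}\boldsymbol s_{\mathcal N_i}+z_{\mathcal N_i}=[Y_j\boldsymbol s_j+z_j]_{j\in\mathcal N_i}$. **Policies.** $\mathcal{SC}(\boldsymbol\xi_i,\boldsymbol\zeta_{\mathcal N_i})$ is the space of policies $\boldsymbol\Psi_i=[\Psi_{i,t}]_{t\in\mathcal T}$ with $u_{i,t}=\Psi_{i,t}(\boldsymbol\xi_i^{t-1},\boldsymbol\zeta_{\mathcal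 N_i}^t)$, and $\mathcal{SC}(\boldsymbol\xi_i,\boldsymbol s_{\mathcal N_i})$ is the space of policies $\boldsymbol\Gamma_i=[\Gamma_{i,t}]_{t\in\mathcal T}$ with $u_{i,t}=\Gamma_{i,t}(\boldsymbol\xi_i^{t-1},\boldsymbol s_{\mathcal N_i}^t)$. **Problem $(\mathrm{L}:\mathcal{SC}(\boldsymbol\xi_i,\boldsymbol\zeta_{\mathcal N_i}),\mathcal F_{\mathcal{AT}}(\mathcal S_i))$:** minimize $\sum_{i=1}^M\max_{\boldsymbol\xi_i\in\Xi_i,\,\boldsymbol\zeta_{\mathcal N_i}\in\widehat{\mathcal X}_{\mathcal N_i}(y_{\mathcal N_i},z_{\mathcal N_i})}J_i(\boldsymbol x_i,\boldsymbol u_i)$ over $\boldsymbol\Psi_i\in\mathcal{SC}(\boldsymbol\xi_i,\boldsymbol\zeta_{\mathcal N_i})$, $y_i$ and $z_i$, $i\in\mathcal M$, subject to, for all $i\in\mathcal M$, all $\boldsymbol\xi_i\in\Xi_i$ and all $\boldsymbol\zeta_{\mathcal N_i}\in\widehat{\mathcal X}_{\mathcal N_i}(y_{\mathcal N_i},z_{\mathcal N_i})$: $\boldsymbol u_i=\boldsymbol\Psi_i(\boldsymbol\xi_i,\boldsymbol\zeta_{\mathcal N_i})$, $\boldsymbol x_i=f_i(\boldsymbol\zeta_{\mathcal N_i},\boldsymbol u_i,\boldsymbol\xi_i)$, $(\boldsymbol x_i,\boldsymbol u_i)\in\mathcal O_i$, $\boldsymbol x_i\in\widehat{\mathcal X}_i(y_i,z_i)$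 with $\widehat{\mathcal X}_i(y_i,z_i)\in\mathcal F_{\mathcal{AT}}(\mathcal S_i)$. **Problem $(\mathrm{L}:\mathcal{SC}(\boldsymbol\xi_i,\boldsymbol s_{\mathcal N_i}),\mathcal F_{\mathcal{AT}}(\mathcal S_i))$:** minimize $\sum_{i=1}^M\max_{\boldsymbol\xi_i\in\Xi_i,\,\boldsymbol s_{\mathcal N_i}\in\mathcal S_{\mathcal N_i}}J_i(\boldsymbol x_i,\boldsymbol u_i)$ over $\boldsymbol\Gamma_i\in\mathcal{SC}(\boldsymbol\xi_i,\boldsymbol s_{\mathcal N_i})$, $y_i$ and $z_i$, $i\in\mathcal M$, subject to, for all $i\in\mathcal M$, all $\boldsymbol\xi_i\in\Xi_i$ and all $\boldsymbol s_{\mathcal N_i}\in\mathcal S_{\mathcal N_i}$: $\boldsymbol u_i=\boldsymbol\Gamma_i(\boldsymbol\xi_i,\boldsymbol s_{\mathcal N_i})$, $\boldsymbol\zeta_{\mathcal N_i}=Y_{\mathcal N_i}\boldsymbol s_{\mathcal N_i}+z_{\mathcal N_i}$, $\boldsymbol x_i=f_i(\boldsymbol\zeta_{\mathcal N_i},\boldsymbol u_i,\boldsymbol\xi_i)$, $(\boldsymbol x_i,\boldsymbol u_i)\in\mathcal O_i$, $\boldsymbol x_i\in\widehat{\mathcal X}_i(y_i,z_i)$ with $\widehat{\mathcal X}_i(y_i,z_i)\in\mathcal F_{\mathcal{AT}}(\mathcal S_i)$.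
   Formalization: The formal theorem additionally assumes that every S_i is nonempty and that each projection P_{i,k} is causal (stages 1..t of P_{i,k}s depend only on stages 1..t of s); for projections that mix stages the claim is false. *)

theory Defs
  imports
    "HOL-Analysis.Abstract_Euclidean_Space"
    "HOL-Library.Extended_Real"
    "HOL-Library.FuncSet"
    "Jordan_Normal_Form.DL_Rank"
begin

section \<open>Real vectors of varying dimension\<close>

text \<open>The dimensions depend on the agent, so vectors and matrices are those of
  \<open>Jordan_Normal_Form\<close>, with explicit carriers. Compactness is transported
  from \<open>Euclidean_space n\<close>, whose points are the functions vanishing from index \<open>n\<close> on.\<close>

definition compact_vec :: "nat \<Rightarrow> real vec set \<Rightarrow> bool" where
  "compact_vec n S \<longleftrightarrow> S \<subseteq> carrier_vec n \<and>
     compactin (Euclidean_space n) ((\<lambda>v r. if r < n then v $ r else 0) ` S)"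

definition convex_vec :: "nat \<Rightarrow> real vec set \<Rightarrow> bool" where
  "convex_vec n S \<longleftrightarrow> S \<subseteq> carrier_vec n \<and>
     (\<forall>v\<in>S. \<forall>w\<in>S. \<forall>a\<ge>0. \<forall>b\<ge>0. a + b = 1 \<longrightarrow> a \<cdot>\<^sub>v v + b \<cdot>\<^sub>v w \<in> S)"

text \<open>As for \<open>convex_cone\<close> in HOL-Analysis, a cone is nonempty and contains the origin.\<close>

definition convex_cone_vec :: "nat \<Rightarrow> real vec set \<Rightarrow> bool" where
  "convex_cone_vec n S \<longleftrightarrow> S \<noteq> {} \<and> convex_vec n S \<and> (\<forall>v\<in>S. \<forall>c\<ge>0. c \<cdot>\<^sub>v v \<in> S)"

definition polyhedron_vec :: "nat \<Rightarrow> real vec set \<Rightarrow> bool" where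
  "polyhedron_vec n S \<longleftrightarrow>
     (\<exists>m W w. W \<in> carrier_mat m n \<and> w \<in> carrier_vec m \<and> S = {v \<in> carrier_vec n. W *\<^sub>v v \<le> w})"

definition conic_le :: "real vec set \<Rightarrow> real vec \<Rightarrow> real vec \<Rightarrow> bool" where
  "conic_le C a b \<longleftrightarrow> b - a \<in> C"

definition full_col_rank :: "real mat \<Rightarrow> bool" where
  "full_col_rank A \<longleftrightarrow> vec_space.rank (dim_row A) A = dim_col A"

definition orthogonal_projection :: "nat \<Rightarrow> real mat \<Rightarrow> bool" where
  "orthogonal_projection n P \<longleftrightarrow> P \<in> carrier_mat n n \<and> P * P = P \<and> transpose_mat P = P"

definition p_norm :: "ereal \<Rightarrow> real vec \<Rightarrow> real" where
  "p_norm p v =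
     (if p = \<infinity> then Max (insert 0 {\<bar>v $ r\<bar> |r. r < dim_vec v})
      else (\<Sum>r<dim_vec v. \<bar>v $ r\<bar> powr real_of_ereal p) powr (1 / real_of_ereal p))"

text \<open>Stacking column vectors, and the \<open>t\<close>-th block (\<open>t \<ge> 1\<close>) of length \<open>n\<close> of a stacked vector.\<close>

definition stack :: "real vec list \<Rightarrow> real vec" where
  "stack vs = vec_of_list (concat (map list_of_vec vs))"

definition block :: "nat \<Rightarrow> real vec \<Rightarrow> nat \<Rightarrow> real vec" where
  "block n v t = vec n (\<lambda>r. v $ ((t - 1) * n + r))"


section \<open>The network\<close>

text \<open>Agents are \<open>{1..agents}\<close>, stages \<open>{1..horizon}\<close>; the blocks of the forecast sets are
  indexed by \<open>k < nblk i\<close>, in agreement with the indexing of vectors. Trajectories over all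
  stages are stacked vectors.\<close>

record network =
  agents :: nat
  horizon :: nat
  nbrs :: "nat \<Rightarrow> nat set"
  nx :: "nat \<Rightarrow> nat"
  nu :: "nat \<Rightarrow> nat"
  nxi :: "nat \<Rightarrow> nat"
  x_init :: "nat \<Rightarrow> real vec"
  Amat :: "nat \<Rightarrow> nat \<Rightarrow> real mat"
  Bmat :: "nat \<Rightarrow> nat \<Rightarrow> real mat"
  Dmat :: "nat \<Rightarrow> nat \<Rightarrow> real mat"
  Emat :: "nat \<Rightarrow> nat \<Rightarrow> real mat"
  Hxmat :: "nat \<Rightarrow> real mat"
  Humat :: "nat \<Rightarrow> real mat"
  hvec :: "nat \<Rightarrow> real vec"
  Qmat :: "nat \<Rightarrow> real mat"
  Rmat :: "nat \<Rightarrow> real mat"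
  cost_p :: ereal
  Xi :: "nat \<Rightarrow> real vec set"
  nblk :: "nat \<Rightarrow> nat"
  Pmat :: "nat \<Rightarrow> nat \<Rightarrow> real mat"
  Gmat :: "nat \<Rightarrow> nat \<Rightarrow> real mat"
  gvec :: "nat \<Rightarrow> nat \<Rightarrow> real vec"
  Cone :: "nat \<Rightarrow> nat \<Rightarrow> real vec set"

definition Nx :: "network \<Rightarrow> nat \<Rightarrow> nat" where
  "Nx net i = (horizon net + 1) * nx net i"

definition primitive_set :: "network \<Rightarrow> nat \<Rightarrow> real vec set" where
  "primitive_set net i =
     {s \<in> carrier_vec (Nx net i). \<forall>k<nblk net i.
        conic_le (Cone net i k) (Gmat net i k *\<^sub>v (Pmat net i k *\<^sub>v s)) (gvec net i k)}"

definition forecast_set :: "network \<Rightarrow> nat \<Rightarrow> real vec \<Rightarrow> real vec \<Rightarrow> real vec set" where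
  "forecast_set net i y z =
     {x \<in> carrier_vec (Nx net i). \<exists>\<nu>. (\<forall>k<nblk net i. \<nu> k \<in> carrier_vec (Nx net i)) \<and>
        x = finsum_vec TYPE(real) (Nx net i) (\<lambda>k. Pmat net i k *\<^sub>v \<nu> k) {..<nblk net i} + z \<and>
        (\<forall>k<nblk net i.
           conic_le (Cone net i k) (Gmat net i k *\<^sub>v (Pmat net i k *\<^sub>v \<nu> k)) (y $ k \<cdot>\<^sub>v gvec net i k))}"

definition F_AT :: "network \<Rightarrow> nat \<Rightarrow> real vec set set" where
  "F_AT net i =
     {forecast_set net i y z | y z.
        y \<in> carrier_vec (nblk net i) \<and> 0\<^sub>v (nblk net i) \<le> y \<and> z \<in> carrier_vec (Nx net i)}"

definition Ymat :: "network \<Rightarrow> nat \<Rightarrow> real vec \<Rightarrow> real mat" where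
  "Ymat net i y = mat (Nx net i) (Nx net i) (\<lambda>(r, c). \<Sum>k<nblk net i. y $ k * Pmat net i k $$ (r, c))"

definition valid_network :: "network \<Rightarrow> bool" where
  "valid_network net \<longleftrightarrow>
     cost_p net \<in> {1, 2, \<infinity>} \<and>
     (\<forall>i\<in>{1..agents net}.
        nbrs net i \<subseteq> {1..agents net} \<and>
        x_init net i \<in> carrier_vec (nx net i) \<and>
        (\<forall>t\<in>{1..horizon net}.
           Amat net i t \<in> carrier_mat (nx net i) (nx net i) \<and>
           Bmat net i t \<in> carrier_mat (nx net i) (\<Sum>j\<in>nbrs net i. nx net j) \<and>
           Dmat net i t \<in> carrier_mat (nx net i) (nu net i) \<and>
           Emat net i t \<in> carrier_mat (nx net i) (nxi net i) \<and>
           full_col_rank (Amat net i t) \<and> full_col_rank (Bmat net i t) \<and>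
           full_col_rank (Dmat net i t) \<and> full_col_rank (Emat net i t)) \<and>
        (\<exists>m. Hxmat net i \<in> carrier_mat m (Nx net i) \<and>
             Humat net i \<in> carrier_mat m (horizon net * nu net i) \<and>
             hvec net i \<in> carrier_vec m) \<and>
        (\<exists>m. Qmat net i \<in> carrier_mat m (nx net i)) \<and>
        (\<exists>m. Rmat net i \<in> carrier_mat m (nu net i)) \<and>
        Xi net i \<noteq> {} \<and>
        convex_vec (horizon net * nxi net i) (Xi net i) \<and>
        compact_vec (horizon net * nxi net i) (Xi net i) \<and>
        polyhedron_vec (horizon net * nxi net i) (Xi net i) \<and>
        nblk net i > 0 \<and>
        (\<forall>k<nblk net i. orthogonal_projection (Nx net i) (Pmat net i k)) \<and>
        (\<forall>x\<in>carrier_vec (Nx net i).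
           x = finsum_vec TYPE(real) (Nx net i) (\<lambda>k. Pmat net i k *\<^sub>v x) {..<nblk net i}) \<and>
        (\<forall>k<nblk net i. \<exists>m.
           Gmat net i k \<in> carrier_mat m (Nx net i) \<and>
           gvec net i k \<in> carrier_vec m \<and>
           convex_cone_vec m (Cone net i k)) \<and>
        compact_vec (Nx net i) (primitive_set net i))"

text \<open>Causality of the projections: stages \<open>1,\<dots>,t\<close> of \<open>Pmat net i k *\<^sub>v s\<close> depend only on
  stages \<open>1,\<dots>,t\<close> of \<open>s\<close>. Without it \<open>s \<mapsto> Ymat net i y *\<^sub>v s + z\<close> and its inverse need not map
  histories to histories, and the two policy spaces are not comparable.\<close>

definition causal_projections :: "network \<Rightarrow> bool" where
  "causal_projections net \<longleftrightarrow>
     (\<forall>i\<in>{1..agents net}. \<forall>k<nblk net i. \<forall>r<Nx net i. \<forall>c<Nx net i.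
        r div nx net i < c div nx net i \<longrightarrow> Pmat net i k $$ (r, c) = 0)"


section \<open>Dynamics, constraints and cost\<close>

text \<open>Families \<open>\<zeta> :: nat \<Rightarrow> real vec\<close> stand for the neighbours' stacked trajectories. Stages count
  from 1; the value of \<open>state\<close> at stage 0 is a dummy.\<close>

fun state :: "network \<Rightarrow> nat \<Rightarrow> (nat \<Rightarrow> real vec) \<Rightarrow> real vec \<Rightarrow> real vec \<Rightarrow> nat \<Rightarrow> real vec" where
  "state net i \<zeta> u \<xi> 0 = x_init net i"
| "state net i \<zeta> u \<xi> (Suc t) =
     (if t = 0 then x_init net i
      else Amat net i t *\<^sub>v state net i \<zeta> u \<xi> t
         + Bmat net i t *\<^sub>v stack (map (\<lambda>j. block (nx net j) (\<zeta> j) t) (sorted_list_of_set (nbrs net i)))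
         + Dmat net i t *\<^sub>v block (nu net i) u t
         + Emat net i t *\<^sub>v block (nxi net i) \<xi> t)"

definition dynamics ::
    "network \<Rightarrow> nat \<Rightarrow> (nat \<Rightarrow> real vec) \<Rightarrow> real vec \<Rightarrow> real vec \<Rightarrow> real vec" where
  "dynamics net i \<zeta> u \<xi> = stack (map (state net i \<zeta> u \<xi>) [1..<horizon net + 2])"

definition op_constraints :: "network \<Rightarrow> nat \<Rightarrow> (real vec \<times> real vec) set" where
  "op_constraints net i =
     {(x, u). x \<in> carrier_vec (Nx net i) \<and> u \<in> carrier_vec (horizon net * nu net i) \<and>
              Hxmat net i *\<^sub>v x + Humat net i *\<^sub>v u \<le> hvec net i}"

definition cost :: "network \<Rightarrow> nat \<Rightarrow> real vec \<Rightarrow> real vec \<Rightarrow> real" where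
  "cost net i x u =
     (\<Sum>t=1..horizon net. p_norm (cost_p net) (Qmat net i *\<^sub>v block (nx net i) x t)
                       + p_norm (cost_p net) (Rmat net i *\<^sub>v block (nu net i) u t))"


section \<open>Policies\<close>

text \<open>A policy of an agent maps a stage \<open>t\<close>, a disturbance history of \<open>t - 1\<close> stages and
  histories of \<open>t\<close> stages, one per neighbour, to an input. Since \<open>\<zeta>\<^sub>j\<close> and \<open>s\<^sub>j\<close> have the same
  dimension, one space serves for both information structures.\<close>

type_synonym policy = "nat \<Rightarrow> real vec \<Rightarrow> (nat \<Rightarrow> real vec) \<Rightarrow> real vec"

definition SC :: "network \<Rightarrow> nat \<Rightarrow> policy set" where
  "SC net i =
     {\<Psi>. \<forall>t\<in>{1..horizon net}.
        \<forall>\<xi>\<in>carrier_vec ((t - 1) * nxi net i).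
        \<forall>\<zeta>\<in>(\<Pi>\<^sub>E j\<in>nbrs net i. carrier_vec (t * nx net j)). \<Psi> t \<xi> \<zeta> \<in> carrier_vec (nu net i)}"

definition apply_policy ::
    "network \<Rightarrow> nat \<Rightarrow> policy \<Rightarrow> real vec \<Rightarrow> (nat \<Rightarrow> real vec) \<Rightarrow> real vec" where
  "apply_policy net i \<Psi> \<xi> \<zeta> =
     stack (map (\<lambda>t. \<Psi> t (vec_first \<xi> ((t - 1) * nxi net i))
                         (\<lambda>j\<in>nbrs net i. vec_first (\<zeta> j) (t * nx net j)))
              [1..<horizon net + 1])"


section \<open>The two problems\<close>

text \<open>A decision consists of the policies and of the parameters \<open>y\<close> and \<open>z\<close> of all agents.
  Worst-case costs and optimal values are taken in \<open>ereal\<close>: the maximum over the uncertainty is a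
  supremum, as arbitrary policies need not attain it, and an infeasible problem has value \<open>\<infinity>\<close>.\<close>

type_synonym decision = "(nat \<Rightarrow> policy) \<times> (nat \<Rightarrow> real vec) \<times> (nat \<Rightarrow> real vec)"

definition admissible_params :: "network \<Rightarrow> nat \<Rightarrow> real vec \<Rightarrow> real vec \<Rightarrow> bool" where
  "admissible_params net i y z \<longleftrightarrow>
     y \<in> carrier_vec (nblk net i) \<and> 0\<^sub>v (nblk net i) \<le> y \<and> z \<in> carrier_vec (Nx net i) \<and>
     forecast_set net i y z \<in> F_AT net i"

definition nbr_forecast ::
    "network \<Rightarrow> nat \<Rightarrow> (nat \<Rightarrow> real vec) \<Rightarrow> (nat \<Rightarrow> real vec) \<Rightarrow> (nat \<Rightarrow> real vec) set" where
  "nbr_forecast net i y z = (\<Pi>\<^sub>E j\<in>nbrs net i. forecast_set net j (y j) (z j))"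

definition nbr_primitive :: "network \<Rightarrow> nat \<Rightarrow> (nat \<Rightarrow> real vec) set" where
  "nbr_primitive net i = (\<Pi>\<^sub>E j\<in>nbrs net i. primitive_set net j)"

definition nbr_affine ::
    "network \<Rightarrow> nat \<Rightarrow> (nat \<Rightarrow> real vec) \<Rightarrow> (nat \<Rightarrow> real vec) \<Rightarrow> (nat \<Rightarrow> real vec) \<Rightarrow> nat \<Rightarrow> real vec" where
  "nbr_affine net i y z s = (\<lambda>j\<in>nbrs net i. Ymat net j (y j) *\<^sub>v s j + z j)"

fun feasible_zeta :: "network \<Rightarrow> decision \<Rightarrow> bool" where
  "feasible_zeta net (\<Psi>, y, z) \<longleftrightarrow>
     (\<forall>i\<in>{1..agents net}.
        \<Psi> i \<in> SC net i \<and> admissible_params net i (y i) (z i) \<and>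
        (\<forall>\<xi>\<in>Xi net i. \<forall>\<zeta>\<in>nbr_forecast net i y z.
           let u = apply_policy net i (\<Psi> i) \<xi> \<zeta>;
               x = dynamics net i \<zeta> u \<xi>
           in (x, u) \<in> op_constraints net i \<and> x \<in> forecast_set net i (y i) (z i)))"

fun objective_zeta :: "network \<Rightarrow> decision \<Rightarrow> ereal" where
  "objective_zeta net (\<Psi>, y, z) =
     (\<Sum>i=1..agents net. SUP (\<xi>, \<zeta>)\<in>Xi net i \<times> nbr_forecast net i y z.
        let u = apply_policy net i (\<Psi> i) \<xi> \<zeta>;
            x = dynamics net i \<zeta> u \<xi>
        in ereal (cost net i x u))"

fun feasible_s :: "network \<Rightarrow> decision \<Rightarrow> bool" where
  "feasible_s net (\<Gamma>, y, z) \<longleftrightarrow>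
     (\<forall>i\<in>{1..agents net}.
        \<Gamma> i \<in> SC net i \<and> admissible_params net i (y i) (z i) \<and>
        (\<forall>\<xi>\<in>Xi net i. \<forall>s\<in>nbr_primitive net i.
           let u = apply_policy net i (\<Gamma> i) \<xi> s;
               \<zeta> = nbr_affine net i y z s;
               x = dynamics net i \<zeta> u \<xi>
           in (x, u) \<in> op_constraints net i \<and> x \<in> forecast_set net i (y i) (z i)))"

fun objective_s :: "network \<Rightarrow> decision \<Rightarrow> ereal" where
  "objective_s net (\<Gamma>, y, z) =
     (\<Sum>i=1..agents net. SUP (\<xi>, s)\<in>Xi net i \<times> nbr_primitive net i.
        let u = apply_policy net i (\<Gamma> i) \<xi> s;
            \<zeta> = nbr_affine net i y z s;
            x = dynamics net i \<zeta> u \<xi>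
        in ereal (cost net i x u))"

definition optimal_value_zeta :: "network \<Rightarrow> ereal" where
  "optimal_value_zeta net = (INF d\<in>{d. feasible_zeta net d}. objective_zeta net d)"

definition optimal_value_s :: "network \<Rightarrow> ereal" where
  "optimal_value_s net = (INF d\<in>{d. feasible_s net d}. objective_s net d)"

end

theory Submission
  imports Defs
begin

text \<open>The two problems differ only in the coordinates in which the neighbours' trajectories are
  observed: \<open>\<zeta>\<^sub>j\<close> ranges over the forecast set, \<open>s\<^sub>j\<close> over the primitive set, and the forecast set is
  the image of the primitive set under \<open>s \<mapsto> Y s + z\<close>. A policy in one coordinate becomes a policy
  in the other by translating its arguments, so everything rests on translations in both directions
  that are compatible with the constraints and with the information available at each stage.

  Geometry. Projections that resolve the identity are mutually orthogonal
  (\<open>projections_orthogonal\<close>). So a vector may be studied component by component: \<open>Y\<close> multiplies the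
  \<open>k\<close>-th component by \<open>y\<^sub>k\<close>, and membership in the forecast set is one conic inequality for each
  component of \<open>x - z\<close> (\<open>forecast_set_by_components\<close>). Where \<open>y\<^sub>k > 0\<close> a component is recovered by
  division. Where \<open>y\<^sub>k = 0\<close> the conic inequality says that the component is a recession direction of
  the primitive set, which is compact and nonempty, so that the component vanishes
  (\<open>unscaled_component_zero\<close>). But then \<open>Y\<close> forgets the \<open>k\<close>-th component of \<open>s\<close>, and \<open>0\<close> need not be
  an admissible replacement, so the right inverse \<open>unscale\<close> fills it in from a fixed
  point of the primitive set.

  Information. Causal projections are block lower triangular, hence so are their combinations.
  Therefore both translations map histories up to stage \<open>t\<close> to histories up to stage \<open>t\<close>, and
  composing a policy with a translation yields a policy again (\<open>apply_policy_reparametrize\<close>).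

  Values. Translation preserves inputs, states and costs scenario by scenario. Since
  \<open>s \<mapsto> Y s + z\<close> is onto, passing from \<open>\<zeta>\<close>-policies to \<open>s\<close>-policies leaves the worst case unchanged.
  In the other direction only those \<open>s\<close> occur that are in the range of \<open>unscale\<close>, so the worst case
  can decrease, because an \<open>s\<close>-policy may depend on the components of \<open>s\<close> that \<open>Y\<close> forgets.
  These two comparisons give equal optimal values.\<close>

(* The notation for vectors indexed by finite types clashes with the one for explicit carriers. *)
unbundle no vec_syntax and no inner_syntax

section \<open>Resolutions of the identity by orthogonal projections\<close>

lemma vec_add_diff_cancel:
  fixes v w :: "real vec"
  assumes "v \<in> carrier_vec n" "w \<in> carrier_vec n"
  shows "v + w - w = v" "v - w + w = v"
  using assms by (auto intro!: eq_vecI)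

lemma vec_add_zero_smult:
  fixes v w :: "real vec"
  assumes "v \<in> carrier_vec n" "w \<in> carrier_vec n"
  shows "v + c \<cdot>\<^sub>v 0\<^sub>v n = v" "v + 0 \<cdot>\<^sub>v w = v" "0 \<cdot>\<^sub>v w + v = v"
  using assms by (auto intro!: eq_vecI)

lemma smult_diff_distrib_vec:
  fixes v w :: "real vec"
  assumes "v \<in> carrier_vec n" "w \<in> carrier_vec n"
  shows "c \<cdot>\<^sub>v (v - w) = c \<cdot>\<^sub>v v - c \<cdot>\<^sub>v w"
  using assms by (auto intro!: eq_vecI simp: right_diff_distrib)

lemma mult_mat_vec_nth:
  fixes A :: "real mat"
  assumes "A \<in> carrier_mat m n" "v \<in> carrier_vec n" "r < m"
  shows "(A *\<^sub>v v) $ r = (\<Sum>c<n. A $$ (r, c) * v $ c)"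
  using assms by (auto simp: scalar_prod_def lessThan_atLeast0 intro!: sum.cong)

lemma mult_mat_vec_finsum_vec:
  fixes A :: "real mat"
  assumes A: "A \<in> carrier_mat m n" and F: "finite F"
    and v: "\<And>k. k \<in> F \<Longrightarrow> v k \<in> carrier_vec n"
  shows "A *\<^sub>v finsum_vec TYPE(real) n v F = finsum_vec TYPE(real) m (\<lambda>k. A *\<^sub>v v k) F"
proof (rule eq_vecI)
  have Fm: "finsum_vec TYPE(real) m (\<lambda>k. A *\<^sub>v v k) F \<in> carrier_vec m"
    using A v by (intro finsum_vec_closed) auto
  have Fn: "finsum_vec TYPE(real) n v F \<in> carrier_vec n"
    using v by (intro finsum_vec_closed) auto
  show "dim_vec (A *\<^sub>v finsum_vec TYPE(real) n v F)
      = dim_vec (finsum_vec TYPE(real) m (\<lambda>k. A *\<^sub>v v k) F)"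
    using Fm A by auto
  fix r assume "r < dim_vec (finsum_vec TYPE(real) m (\<lambda>k. A *\<^sub>v v k) F)"
  then have r: "r < m" using Fm by auto
  have "(A *\<^sub>v finsum_vec TYPE(real) n v F) $ r
      = (\<Sum>c<n. A $$ (r, c) * finsum_vec TYPE(real) n v F $ c)"
    by (rule mult_mat_vec_nth[OF A Fn r])
  also have "\<dots> = (\<Sum>c<n. A $$ (r, c) * (\<Sum>k\<in>F. v k $ c))"
    using F v by (intro sum.cong refl arg_cong2[where f = "(*)"] index_finsum_vec) auto
  also have "\<dots> = (\<Sum>k\<in>F. \<Sum>c<n. A $$ (r, c) * v k $ c)"
    unfolding sum_distrib_left by (rule sum.swap)
  also have "\<dots> = (\<Sum>k\<in>F. (A *\<^sub>v v k) $ r)"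
    using A v r by (intro sum.cong refl mult_mat_vec_nth[symmetric]) auto
  also have "\<dots> = finsum_vec TYPE(real) m (\<lambda>k. A *\<^sub>v v k) F $ r"
    using A v r F by (intro index_finsum_vec[symmetric]) auto
  finally show "(A *\<^sub>v finsum_vec TYPE(real) n v F) $ r
      = finsum_vec TYPE(real) m (\<lambda>k. A *\<^sub>v v k) F $ r" .
qed

lemma finsum_vec_cong:
  fixes v w :: "'b \<Rightarrow> real vec"
  assumes "finite F" "\<And>k. k \<in> F \<Longrightarrow> v k \<in> carrier_vec n" "\<And>k. k \<in> F \<Longrightarrow> v k = w k"
  shows "finsum_vec TYPE(real) n v F = finsum_vec TYPE(real) n w F"
proof (rule eq_vecI)
  have c: "finsum_vec TYPE(real) n v F \<in> carrier_vec n" "finsum_vec TYPE(real) n w F \<in> carrier_vec n"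
    using assms by (auto intro!: finsum_vec_closed)
  then show "dim_vec (finsum_vec TYPE(real) n v F) = dim_vec (finsum_vec TYPE(real) n w F)" by auto
  fix r assume "r < dim_vec (finsum_vec TYPE(real) n w F)"
  then have "r < n" using c by auto
  then show "finsum_vec TYPE(real) n v F $ r = finsum_vec TYPE(real) n w F $ r"
    using assms by (subst (1 2) index_finsum_vec) (auto intro!: sum.cong)
qed

locale projection_resolution =
  fixes n K :: nat and P :: "nat \<Rightarrow> real mat"
  assumes projection: "\<And>k. k < K \<Longrightarrow> orthogonal_projection n (P k)"
    and resolution: "\<And>x. x \<in> carrier_vec n \<Longrightarrow>
      x = finsum_vec TYPE(real) n (\<lambda>k. P k *\<^sub>v x) {..<K}"
begin

lemma projection_carrier: "k < K \<Longrightarrow> P k \<in> carrier_mat n n"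
  using projection by (auto simp: orthogonal_projection_def)

lemma projection_mult_carrier [simp]:
  "k < K \<Longrightarrow> x \<in> carrier_vec n \<Longrightarrow> P k *\<^sub>v x \<in> carrier_vec n"
  by (rule mult_mat_vec_carrier[OF projection_carrier])

lemma projection_idem:
  "k < K \<Longrightarrow> x \<in> carrier_vec n \<Longrightarrow> P k *\<^sub>v (P k *\<^sub>v x) = P k *\<^sub>v x"
  using projection[of k] assoc_mult_mat_vec[of "P k" n n "P k" n x]
  by (auto simp: orthogonal_projection_def)

text \<open>The components determine the vector, so identities can be checked one component at a time.\<close>

lemma eq_by_components:
  assumes "x \<in> carrier_vec n" "y \<in> carrier_vec n" "\<And>k. k < K \<Longrightarrow> P k *\<^sub>v x = P k *\<^sub>v y"
  shows "x = y"
  using resolution[OF assms(1)] resolution[OF assms(2)] assms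
    finsum_vec_cong[of "{..<K}" "\<lambda>k. P k *\<^sub>v x" n "\<lambda>k. P k *\<^sub>v y"]
  by auto

lemma scalar_prod_component:
  assumes k: "k < K" and x: "x \<in> carrier_vec n"
  shows "x \<bullet> (P k *\<^sub>v x) = (P k *\<^sub>v x) \<bullet> (P k *\<^sub>v x)"
proof -
  have "(P k *\<^sub>v x) \<bullet> (P k *\<^sub>v x) = (transpose_mat (P k) *\<^sub>v x) \<bullet> (P k *\<^sub>v x)"
    using projection[OF k] by (auto simp: orthogonal_projection_def)
  also have "\<dots> = x \<bullet> (P k *\<^sub>v (P k *\<^sub>v x))"
    using k x by (intro transpose_vec_mult_scalar[OF projection_carrier]) auto
  finally show ?thesis using projection_idem[OF k x] by simp
qed

text \<open>By Pythagoras \<open>\<bar>x\<bar>\<^sup>2\<close> is the sum of the \<open>\<bar>P k x\<bar>\<^sup>2\<close>. For \<open>x\<close> in the range of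
  \<open>P l\<close> the \<open>l\<close>-th term already equals \<open>\<bar>x\<bar>\<^sup>2\<close>, hence the others vanish.\<close>

lemma projections_orthogonal:
  assumes k: "k < K" and l: "l < K" and "k \<noteq> l" and v: "v \<in> carrier_vec n"
  shows "P k *\<^sub>v (P l *\<^sub>v v) = 0\<^sub>v n"
proof -
  define x where "x = P l *\<^sub>v v"
  have x: "x \<in> carrier_vec n" and Plx: "P l *\<^sub>v x = x"
    using l v projection_idem unfolding x_def by auto
  have nonneg: "(P j *\<^sub>v x) \<bullet> (P j *\<^sub>v x) \<ge> 0" for j
    by (auto simp: scalar_prod_def intro!: sum_nonneg)
  have "x \<bullet> x = (\<Sum>r<n. x $ r * finsum_vec TYPE(real) n (\<lambda>k. P k *\<^sub>v x) {..<K} $ r)"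
    using x resolution[OF x, symmetric] by (simp add: scalar_prod_def lessThan_atLeast0)
  also have "\<dots> = (\<Sum>r<n. x $ r * (\<Sum>j<K. (P j *\<^sub>v x) $ r))"
    using x by (intro sum.cong refl arg_cong2[where f = "(*)"] index_finsum_vec) auto
  also have "\<dots> = (\<Sum>j<K. \<Sum>r<n. x $ r * (P j *\<^sub>v x) $ r)"
    unfolding sum_distrib_left by (rule sum.swap)
  also have "\<dots> = (\<Sum>j<K. (P j *\<^sub>v x) \<bullet> (P j *\<^sub>v x))"
  proof (intro sum.cong refl)
    fix j assume "j \<in> {..<K}"
    then have j: "j < K" by simp
    show "(\<Sum>r<n. x $ r * (P j *\<^sub>v x) $ r) = (P j *\<^sub>v x) \<bullet> (P j *\<^sub>v x)"
      using carrier_vecD[OF projection_mult_carrier[OF j x]] scalar_prod_component[OF j x]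
      by (simp add: scalar_prod_def lessThan_atLeast0 del: dim_mult_mat_vec index_mult_mat_vec)
  qed
  also have "\<dots> = x \<bullet> x + (\<Sum>j\<in>{..<K} - {l}. (P j *\<^sub>v x) \<bullet> (P j *\<^sub>v x))"
    using l Plx by (subst sum.remove[of _ l]) auto
  finally have "(\<Sum>j\<in>{..<K} - {l}. (P j *\<^sub>v x) \<bullet> (P j *\<^sub>v x)) = 0" by simp
  then have "(P k *\<^sub>v x) \<bullet> (P k *\<^sub>v x) = 0"
    using k \<open>k \<noteq> l\<close> nonneg by (subst (asm) sum_nonneg_eq_0_iff) auto
  then have "P k *\<^sub>v x = 0\<^sub>v n"
    using conjugate_square_eq_0_vec[OF projection_mult_carrier[OF k x]] by simp
  then show ?thesis by (simp add: x_def)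
qed

text \<open>Orthogonality decouples the components, so the representation of a vector in a forecast set
  determines each \<open>P k \<nu>\<^sub>k\<close>, although not \<open>\<nu>\<^sub>k\<close> itself.\<close>

lemma component_of_combination:
  assumes k: "k < K" and \<nu>: "\<And>l. l < K \<Longrightarrow> \<nu> l \<in> carrier_vec n"
  shows "P k *\<^sub>v finsum_vec TYPE(real) n (\<lambda>l. P l *\<^sub>v \<nu> l) {..<K} = P k *\<^sub>v \<nu> k"
proof (rule eq_vecI)
  show "dim_vec (P k *\<^sub>v finsum_vec TYPE(real) n (\<lambda>l. P l *\<^sub>v \<nu> l) {..<K}) = dim_vec (P k *\<^sub>v \<nu> k)"
    by simp
  fix r assume "r < dim_vec (P k *\<^sub>v \<nu> k)"
  then have r: "r < n" using projection_carrier[OF k] by simp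
  have "(P k *\<^sub>v finsum_vec TYPE(real) n (\<lambda>l. P l *\<^sub>v \<nu> l) {..<K}) $ r
      = (\<Sum>l<K. (P k *\<^sub>v (P l *\<^sub>v \<nu> l)) $ r)"
    using k r \<nu> by (subst mult_mat_vec_finsum_vec[OF projection_carrier[OF k]])
      (auto intro!: index_finsum_vec)
  also have "\<dots> = (\<Sum>l<K. if l = k then (P k *\<^sub>v \<nu> k) $ r else 0)"
    using k r \<nu> by (intro sum.cong) (simp_all add: projection_idem projections_orthogonal)
  also have "\<dots> = (P k *\<^sub>v \<nu> k) $ r" using k by simp
  finally show "(P k *\<^sub>v finsum_vec TYPE(real) n (\<lambda>l. P l *\<^sub>v \<nu> l) {..<K}) $ r
      = (P k *\<^sub>v \<nu> k) $ r" .
qed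

text \<open>The diagonal operators of the decomposition. They serve both for the matrix \<open>Y\<close> and for its
  pseudo-inverse, whose weights are not those of a parameter \<open>y\<close>.\<close>

definition scaling :: "(nat \<Rightarrow> real) \<Rightarrow> real mat" where
  "scaling w = mat n n (\<lambda>(r, c). \<Sum>k<K. w k * P k $$ (r, c))"

lemma scaling_carrier [simp]: "scaling w \<in> carrier_mat n n"
  by (simp add: scaling_def)

lemma scaling_mult_carrier [simp]: "x \<in> carrier_vec n \<Longrightarrow> scaling w *\<^sub>v x \<in> carrier_vec n"
  by (rule mult_mat_vec_carrier[OF scaling_carrier])

lemma scaling_mult_vec:
  assumes x: "x \<in> carrier_vec n"
  shows "scaling w *\<^sub>v x = finsum_vec TYPE(real) n (\<lambda>k. P k *\<^sub>v (w k \<cdot>\<^sub>v x)) {..<K}"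
proof (rule eq_vecI)
  have c: "finsum_vec TYPE(real) n (\<lambda>k. P k *\<^sub>v (w k \<cdot>\<^sub>v x)) {..<K} \<in> carrier_vec n"
    using x by (intro finsum_vec_closed) auto
  then show "dim_vec (scaling w *\<^sub>v x) = dim_vec (finsum_vec TYPE(real) n (\<lambda>k. P k *\<^sub>v (w k \<cdot>\<^sub>v x)) {..<K})"
    by (simp add: scaling_def)
  fix r assume "r < dim_vec (finsum_vec TYPE(real) n (\<lambda>k. P k *\<^sub>v (w k \<cdot>\<^sub>v x)) {..<K})"
  then have r: "r < n" using c by auto
  have "(scaling w *\<^sub>v x) $ r = (\<Sum>c<n. (\<Sum>k<K. w k * P k $$ (r, c)) * x $ c)"
    unfolding mult_mat_vec_nth[OF scaling_carrier x r] using r by (simp add: scaling_def)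
  also have "\<dots> = (\<Sum>k<K. \<Sum>c<n. P k $$ (r, c) * (w k * x $ c))"
    unfolding sum_distrib_right by (subst sum.swap) (simp add: mult_ac)
  also have "\<dots> = (\<Sum>k<K. (P k *\<^sub>v (w k \<cdot>\<^sub>v x)) $ r)"
  proof (intro sum.cong refl)
    fix k assume "k \<in> {..<K}"
    then have "k < K" by simp
    from mult_mat_vec_nth[OF projection_carrier[OF this] _ r, of "w k \<cdot>\<^sub>v x"]
    show "(\<Sum>c<n. P k $$ (r, c) * (w k * x $ c)) = (P k *\<^sub>v (w k \<cdot>\<^sub>v x)) $ r"
      using x by simp
  qed
  also have "\<dots> = finsum_vec TYPE(real) n (\<lambda>k. P k *\<^sub>v (w k \<cdot>\<^sub>v x)) {..<K} $ r"
    using x r by (intro index_finsum_vec[symmetric]) auto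
  finally show "(scaling w *\<^sub>v x) $ r = finsum_vec TYPE(real) n (\<lambda>k. P k *\<^sub>v (w k \<cdot>\<^sub>v x)) {..<K} $ r" .
qed

lemma component_scaling:
  assumes "k < K" "x \<in> carrier_vec n"
  shows "P k *\<^sub>v (scaling w *\<^sub>v x) = w k \<cdot>\<^sub>v (P k *\<^sub>v x)"
  using assms mult_mat_vec[OF projection_carrier[OF assms(1)] assms(2)]
    component_of_combination[of k "\<lambda>l. w l \<cdot>\<^sub>v x"]
  by (simp add: scaling_mult_vec)

end

section \<open>Cones and compact sets\<close>

lemma convex_cone_vec_smult:
  "convex_cone_vec m C \<Longrightarrow> v \<in> C \<Longrightarrow> c \<ge> 0 \<Longrightarrow> c \<cdot>\<^sub>v v \<in> C"
  by (auto simp: convex_cone_vec_def)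

text \<open>The midpoint of the two points belongs to the convex set, and doubling it stays in the cone.\<close>

lemma convex_cone_vec_add:
  assumes C: "convex_cone_vec m C" and "v \<in> C" "w \<in> C"
  shows "v + w \<in> C"
proof -
  have cv: "convex_vec m C" using C by (simp add: convex_cone_vec_def)
  then have vw: "v \<in> carrier_vec m" "w \<in> carrier_vec m" using assms by (auto simp: convex_vec_def)
  have "(1/2) \<cdot>\<^sub>v v + (1/2) \<cdot>\<^sub>v w \<in> C"
    using cv assms unfolding convex_vec_def by auto
  then have "2 \<cdot>\<^sub>v ((1/2) \<cdot>\<^sub>v v + (1/2) \<cdot>\<^sub>v w) \<in> C"
    using convex_cone_vec_smult[OF C] by auto
  also have "2 \<cdot>\<^sub>v ((1/2) \<cdot>\<^sub>v v + (1/2) \<cdot>\<^sub>v w) = v + w"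
    using vw by (intro eq_vecI) auto
  finally show ?thesis .
qed

lemma compact_vec_bounded:
  fixes S :: "real vec set"
  assumes S: "compact_vec n S" and r: "r < n"
  obtains B where "\<And>v. v \<in> S \<Longrightarrow> \<bar>v $ r\<bar> \<le> B"
proof -
  let ?emb = "\<lambda>v r. if r < n then v $ r else (0::real)"
  have "continuous_map (Euclidean_space n) euclideanreal (\<lambda>f. f r)"
    unfolding Euclidean_space_def
    by (intro continuous_map_from_subtopology continuous_map_product_projection) simp
  then have "compactin euclideanreal ((\<lambda>f. f r) ` ?emb ` S)"
    using S by (intro image_compactin[of "Euclidean_space n"]) (simp_all add: compact_vec_def)
  then have "bounded ((\<lambda>f. f r) ` ?emb ` S)"
    by (auto intro: compact_imp_bounded)
  then obtain B where "\<forall>x\<in>(\<lambda>f. f r) ` ?emb ` S. \<bar>x\<bar> \<le> B"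
    by (auto simp: bounded_iff)
  then show ?thesis using that r by fastforce
qed

text \<open>Along a ray with \<open>d\<^sub>r \<noteq> 0\<close> the \<open>r\<close>-th coordinate is unbounded.\<close>

lemma compact_vec_no_ray:
  fixes S :: "real vec set" and s d :: "real vec"
  assumes S: "compact_vec n S" and s: "s \<in> carrier_vec n" and d: "d \<in> carrier_vec n"
    and ray: "\<And>c. c \<ge> 0 \<Longrightarrow> s + c \<cdot>\<^sub>v d \<in> S"
  shows "d = 0\<^sub>v n"
proof (rule eq_vecI)
  fix r assume "r < dim_vec (0\<^sub>v n)"
  then have r: "r < n" by simp
  obtain B where B: "\<And>v. v \<in> S \<Longrightarrow> \<bar>v $ r\<bar> \<le> B" using compact_vec_bounded[OF S r] by blast
  have le: "\<bar>s $ r + c * d $ r\<bar> \<le> B" if "c \<ge> 0" for c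
    using B[OF ray[OF that]] s d r by simp
  show "d $ r = 0\<^sub>v n $ r"
  proof (rule ccontr)
    assume "\<not> d $ r = 0\<^sub>v n $ r"
    then have nz: "d $ r \<noteq> 0" using r by simp
    \<comment> \<open>far enough along the ray for the \<open>r\<close>-th coordinate to exceed the bound, wherever \<open>s\<close> lies\<close>
    define c where "c = (B + \<bar>s $ r\<bar> + 1) / \<bar>d $ r\<bar>"
    have B0: "B \<ge> 0" using le[of 0] by simp
    then have "c \<ge> 0" by (simp add: c_def)
    have "\<bar>c * d $ r\<bar> = B + \<bar>s $ r\<bar> + 1" using nz B0 by (simp add: c_def abs_mult)
    then show False using le[OF \<open>c \<ge> 0\<close>] by linarith
  qed
qed (use d in simp)


section \<open>Forecast sets as images of the primitive set\<close>

locale network_agent =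
  fixes net :: network and i :: nat
  assumes valid: "valid_network net" and agent: "i \<in> {1..agents net}"
begin

sublocale projection_resolution "Nx net i" "nblk net i" "Pmat net i"
  using valid agent by unfold_locales (auto simp: valid_network_def)

lemma Ymat_eq_scaling: "Ymat net i y = scaling (\<lambda>k. y $ k)"
  by (simp add: Ymat_def scaling_def)

lemma cone_data:
  assumes "k < nblk net i"
  obtains m where "Gmat net i k \<in> carrier_mat m (Nx net i)" "gvec net i k \<in> carrier_vec m"
    "convex_cone_vec m (Cone net i k)"
  using valid agent assms by (fastforce simp: valid_network_def)

lemma primitive_compact: "compact_vec (Nx net i) (primitive_set net i)"
  using valid agent by (auto simp: valid_network_def)

text \<open>Eliminates the witnesses \<open>\<nu>\<^sub>k\<close>: only their components \<open>P k \<nu>\<^sub>k\<close> enter, and these are the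
  components of \<open>x - z\<close>; conversely \<open>x - z\<close> can serve as every \<open>\<nu>\<^sub>k\<close>.\<close>

lemma forecast_set_by_components:
  assumes z: "z \<in> carrier_vec (Nx net i)"
  shows "x \<in> forecast_set net i y z \<longleftrightarrow>
    x \<in> carrier_vec (Nx net i) \<and>
    (\<forall>k<nblk net i. conic_le (Cone net i k)
       (Gmat net i k *\<^sub>v (Pmat net i k *\<^sub>v (x - z))) (y $ k \<cdot>\<^sub>v gvec net i k))"
  (is "?L \<longleftrightarrow> ?R")
proof
  assume ?L
  then obtain \<nu> where x: "x \<in> carrier_vec (Nx net i)"
    and \<nu>: "\<And>k. k < nblk net i \<Longrightarrow> \<nu> k \<in> carrier_vec (Nx net i)"
    and sum: "x = finsum_vec TYPE(real) (Nx net i) (\<lambda>k. Pmat net i k *\<^sub>v \<nu> k) {..<nblk net i} + z"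
    and le: "\<And>k. k < nblk net i \<Longrightarrow> conic_le (Cone net i k)
       (Gmat net i k *\<^sub>v (Pmat net i k *\<^sub>v \<nu> k)) (y $ k \<cdot>\<^sub>v gvec net i k)"
    unfolding forecast_set_def by auto
  have "finsum_vec TYPE(real) (Nx net i) (\<lambda>k. Pmat net i k *\<^sub>v \<nu> k) {..<nblk net i} \<in> carrier_vec (Nx net i)"
    using \<nu> by (intro finsum_vec_closed) auto
  then have "x - z = finsum_vec TYPE(real) (Nx net i) (\<lambda>k. Pmat net i k *\<^sub>v \<nu> k) {..<nblk net i}"
    unfolding sum by (rule vec_add_diff_cancel[OF _ z])
  then show ?R using x le component_of_combination[of _ \<nu>, OF _ \<nu>] by auto
next
  assume R: ?R
  then have xz: "x - z \<in> carrier_vec (Nx net i)" using z by auto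
  have "x = (x - z) + z" using R z vec_add_diff_cancel(2)[of x _ z] by auto
  then show ?L unfolding forecast_set_def
    using R xz resolution[OF xz] by (auto intro!: exI[of _ "\<lambda>_. x - z"])
qed

text \<open>Multiplying the \<open>k\<close>-th conic inequality by \<open>y\<^sub>k \<ge> 0\<close> preserves it.\<close>

lemma scaled_primitive_in_forecast:
  assumes y: "0\<^sub>v (nblk net i) \<le> y" and z: "z \<in> carrier_vec (Nx net i)"
    and s: "s \<in> primitive_set net i"
  shows "Ymat net i y *\<^sub>v s + z \<in> forecast_set net i y z"
proof -
  have sc: "s \<in> carrier_vec (Nx net i)" using s by (simp add: primitive_set_def)
  have Yc: "Ymat net i y *\<^sub>v s \<in> carrier_vec (Nx net i)" using sc by (simp add: Ymat_eq_scaling)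
  then have diff: "Ymat net i y *\<^sub>v s + z - z = Ymat net i y *\<^sub>v s" by (rule vec_add_diff_cancel[OF _ z])
  have "conic_le (Cone net i k) (Gmat net i k *\<^sub>v (Pmat net i k *\<^sub>v (Ymat net i y *\<^sub>v s)))
          (y $ k \<cdot>\<^sub>v gvec net i k)" if k: "k < nblk net i" for k
  proof -
    obtain m where G: "Gmat net i k \<in> carrier_mat m (Nx net i)" and g: "gvec net i k \<in> carrier_vec m"
      and C: "convex_cone_vec m (Cone net i k)" using cone_data[OF k] .
    have "y $ k \<ge> 0" using y k by (auto simp: less_eq_vec_def)
    moreover have "gvec net i k - Gmat net i k *\<^sub>v (Pmat net i k *\<^sub>v s) \<in> Cone net i k"
      using s k by (auto simp: primitive_set_def conic_le_def)
    ultimately have "y $ k \<cdot>\<^sub>v (gvec net i k - Gmat net i k *\<^sub>v (Pmat net i k *\<^sub>v s)) \<in> Cone net i k"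
      by (rule convex_cone_vec_smult[OF C, rotated])
    also have "y $ k \<cdot>\<^sub>v (gvec net i k - Gmat net i k *\<^sub>v (Pmat net i k *\<^sub>v s))
        = y $ k \<cdot>\<^sub>v gvec net i k - Gmat net i k *\<^sub>v (y $ k \<cdot>\<^sub>v (Pmat net i k *\<^sub>v s))"
      unfolding mult_mat_vec[OF G projection_mult_carrier[OF k sc]]
      by (rule smult_diff_distrib_vec[OF g mult_mat_vec_carrier[OF G projection_mult_carrier[OF k sc]]])
    finally show ?thesis
      unfolding conic_le_def Ymat_eq_scaling component_scaling[OF k sc] .
  qed
  then show ?thesis using Yc z unfolding forecast_set_by_components[OF z] diff by auto
qed

text \<open>For \<open>y\<^sub>k = 0\<close> the conic inequality is homogeneous, so any multiple of the component can be
  added to a point of the primitive set: the \<open>k\<close>-th inequality survives because cones are closed under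
  addition, and the others do not see the \<open>k\<close>-th component. Compactness excludes such a ray.\<close>

lemma unscaled_component_zero:
  fixes y :: "real vec"
  assumes ne: "s0 \<in> primitive_set net i" and z: "z \<in> carrier_vec (Nx net i)"
    and x: "x \<in> forecast_set net i y z" and k: "k < nblk net i" and y0: "y $ k = 0"
  shows "Pmat net i k *\<^sub>v (x - z) = 0\<^sub>v (Nx net i)"
proof (rule compact_vec_no_ray[OF primitive_compact])
  let ?d = "Pmat net i k *\<^sub>v (x - z)"
  show s0: "s0 \<in> carrier_vec (Nx net i)" using ne by (simp add: primitive_set_def)
  have xz: "x - z \<in> carrier_vec (Nx net i)"
    using x z unfolding forecast_set_by_components[OF z] by auto
  then show d: "?d \<in> carrier_vec (Nx net i)" using k by auto
  fix c :: real assume c: "c \<ge> 0"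
  have "conic_le (Cone net i l) (Gmat net i l *\<^sub>v (Pmat net i l *\<^sub>v (s0 + c \<cdot>\<^sub>v ?d))) (gvec net i l)"
    if l: "l < nblk net i" for l
  proof -
    obtain m where G: "Gmat net i l \<in> carrier_mat m (Nx net i)" and g: "gvec net i l \<in> carrier_vec m"
      and C: "convex_cone_vec m (Cone net i l)" using cone_data[OF l] .
    have s0_le: "gvec net i l - Gmat net i l *\<^sub>v (Pmat net i l *\<^sub>v s0) \<in> Cone net i l"
      using ne l by (auto simp: primitive_set_def conic_le_def)
    have comp: "Pmat net i l *\<^sub>v (s0 + c \<cdot>\<^sub>v ?d)
        = Pmat net i l *\<^sub>v s0 + c \<cdot>\<^sub>v (Pmat net i l *\<^sub>v ?d)"
      using s0 d mult_add_distrib_mat_vec[OF projection_carrier[OF l]]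
        mult_mat_vec[OF projection_carrier[OF l] d] by simp
    show ?thesis
    proof (cases "l = k")
      case False
      then have "Pmat net i l *\<^sub>v (s0 + c \<cdot>\<^sub>v ?d) = Pmat net i l *\<^sub>v s0"
        unfolding comp projections_orthogonal[OF l k False xz]
        using vec_add_zero_smult(1)[OF projection_mult_carrier[OF l s0] projection_mult_carrier[OF l s0]]
        by simp
      then show ?thesis using s0_le by (simp add: conic_le_def)
    next
      case True
      have "y $ l \<cdot>\<^sub>v gvec net i l - Gmat net i l *\<^sub>v ?d \<in> Cone net i l"
        using x l True unfolding forecast_set_by_components[OF z] conic_le_def by auto
      then have "c \<cdot>\<^sub>v (y $ l \<cdot>\<^sub>v gvec net i l - Gmat net i l *\<^sub>v ?d) \<in> Cone net i l"
        using c by (rule convex_cone_vec_smult[OF C])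
      from convex_cone_vec_add[OF C s0_le this]
      have "gvec net i l - Gmat net i l *\<^sub>v (Pmat net i l *\<^sub>v s0)
          + c \<cdot>\<^sub>v (y $ l \<cdot>\<^sub>v gvec net i l - Gmat net i l *\<^sub>v ?d) \<in> Cone net i l" .
      also have "gvec net i l - Gmat net i l *\<^sub>v (Pmat net i l *\<^sub>v s0)
          + c \<cdot>\<^sub>v (y $ l \<cdot>\<^sub>v gvec net i l - Gmat net i l *\<^sub>v ?d)
        = gvec net i l - (Gmat net i l *\<^sub>v (Pmat net i l *\<^sub>v s0) + c \<cdot>\<^sub>v (Gmat net i l *\<^sub>v ?d))"
        using carrier_vecD[OF mult_mat_vec_carrier[OF G d]] g y0 True
          carrier_vecD[OF mult_mat_vec_carrier[OF G projection_mult_carrier[OF l s0]]]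
        by (intro eq_vecI) (simp_all del: dim_mult_mat_vec index_mult_mat_vec)
      also have "Gmat net i l *\<^sub>v (Pmat net i l *\<^sub>v s0) + c \<cdot>\<^sub>v (Gmat net i l *\<^sub>v ?d)
        = Gmat net i l *\<^sub>v (Pmat net i l *\<^sub>v (s0 + c \<cdot>\<^sub>v ?d))"
        unfolding comp using True projection_idem[OF k xz] s0 d l
          mult_add_distrib_mat_vec[OF G] mult_mat_vec[OF G d] by simp
      finally show ?thesis by (simp add: conic_le_def)
    qed
  qed
  then show "s0 + c \<cdot>\<^sub>v ?d \<in> primitive_set net i"
    using s0 d unfolding primitive_set_def by auto
qed

text \<open>A right inverse of \<open>s \<mapsto> Y s + z\<close> on the forecast set. The components with \<open>y\<^sub>k = 0\<close> cannot be
  recovered from \<open>x\<close>; they are copied from \<open>s0\<close>, since the point with these components \<open>0\<close> may lie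
  outside the primitive set. Written as a sum of matrix products, it is visibly causal.\<close>

definition unscale :: "real vec \<Rightarrow> real vec \<Rightarrow> real vec \<Rightarrow> real vec \<Rightarrow> real vec" where
  "unscale s0 y z x =
     scaling (\<lambda>k. if y $ k = 0 then 0 else 1 / y $ k) *\<^sub>v (x - z)
   + scaling (\<lambda>k. if y $ k = 0 then 1 else 0) *\<^sub>v s0"

lemma component_unscale:
  assumes s0: "s0 \<in> carrier_vec (Nx net i)" and z: "z \<in> carrier_vec (Nx net i)"
    and x: "x \<in> carrier_vec (Nx net i)" and k: "k < nblk net i"
  shows "Pmat net i k *\<^sub>v unscale s0 y z x =
    (if y $ k = 0 then Pmat net i k *\<^sub>v s0 else (1 / y $ k) \<cdot>\<^sub>v (Pmat net i k *\<^sub>v (x - z)))"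
proof -
  have xz: "x - z \<in> carrier_vec (Nx net i)" using x z by auto
  have "Pmat net i k *\<^sub>v unscale s0 y z x =
      (if y $ k = 0 then 0 else 1 / y $ k) \<cdot>\<^sub>v (Pmat net i k *\<^sub>v (x - z))
    + (if y $ k = 0 then 1 else 0) \<cdot>\<^sub>v (Pmat net i k *\<^sub>v s0)"
    unfolding unscale_def
    using mult_add_distrib_mat_vec[OF projection_carrier[OF k] scaling_mult_carrier[OF xz] scaling_mult_carrier[OF s0]]
      component_scaling[OF k xz] component_scaling[OF k s0] by simp
  then show ?thesis
    using vec_add_zero_smult[OF projection_mult_carrier[OF k s0] projection_mult_carrier[OF k xz]]
      vec_add_zero_smult(2)[OF _ projection_mult_carrier[OF k s0],
        of "(1 / y $ k) \<cdot>\<^sub>v (Pmat net i k *\<^sub>v (x - z))"]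
      projection_mult_carrier[OF k xz] by auto
qed

lemma unscale_carrier:
  assumes "s0 \<in> carrier_vec (Nx net i)" "z \<in> carrier_vec (Nx net i)" "x \<in> carrier_vec (Nx net i)"
  shows "unscale s0 y z x \<in> carrier_vec (Nx net i)"
  using assms unfolding unscale_def by (intro add_carrier_vec scaling_mult_carrier) auto

lemma unscale_in_primitive:
  assumes s0: "s0 \<in> primitive_set net i" and z: "z \<in> carrier_vec (Nx net i)"
    and y: "0\<^sub>v (nblk net i) \<le> y" and x: "x \<in> forecast_set net i y z"
  shows "unscale s0 y z x \<in> primitive_set net i"
proof -
  have s0c: "s0 \<in> carrier_vec (Nx net i)" using s0 by (simp add: primitive_set_def)
  have xc: "x \<in> carrier_vec (Nx net i)" using x unfolding forecast_set_by_components[OF z] by simp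
  then have xz: "x - z \<in> carrier_vec (Nx net i)" using z by auto
  have "conic_le (Cone net i k) (Gmat net i k *\<^sub>v (Pmat net i k *\<^sub>v unscale s0 y z x)) (gvec net i k)"
    if k: "k < nblk net i" for k
  proof (cases "y $ k = 0")
    case True
    then show ?thesis using s0 k component_unscale[OF s0c z xc k] by (simp add: primitive_set_def)
  next
    case False
    obtain m where G: "Gmat net i k \<in> carrier_mat m (Nx net i)" and g: "gvec net i k \<in> carrier_vec m"
      and C: "convex_cone_vec m (Cone net i k)" using cone_data[OF k] .
    have "1 / y $ k \<ge> 0" using y k by (auto simp: less_eq_vec_def)
    moreover have "y $ k \<cdot>\<^sub>v gvec net i k - Gmat net i k *\<^sub>v (Pmat net i k *\<^sub>v (x - z)) \<in> Cone net i k"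
      using x k unfolding forecast_set_by_components[OF z] by (simp add: conic_le_def)
    ultimately have "(1 / y $ k) \<cdot>\<^sub>v (y $ k \<cdot>\<^sub>v gvec net i k - Gmat net i k *\<^sub>v (Pmat net i k *\<^sub>v (x - z)))
        \<in> Cone net i k"
      by (rule convex_cone_vec_smult[OF C, rotated])
    also have "(1 / y $ k) \<cdot>\<^sub>v (y $ k \<cdot>\<^sub>v gvec net i k - Gmat net i k *\<^sub>v (Pmat net i k *\<^sub>v (x - z)))
        = gvec net i k - (1 / y $ k) \<cdot>\<^sub>v (Gmat net i k *\<^sub>v (Pmat net i k *\<^sub>v (x - z)))"
      using smult_diff_distrib_vec[of "y $ k \<cdot>\<^sub>v gvec net i k" m] g False
        mult_mat_vec_carrier[OF G projection_mult_carrier[OF k xz]] by (simp add: smult_smult_assoc)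
    finally show ?thesis
      using False mult_mat_vec[OF G projection_mult_carrier[OF k xz]]
      by (simp add: conic_le_def component_unscale[OF s0c z xc k])
  qed
  then show ?thesis using unscale_carrier[OF s0c z xc] by (simp add: primitive_set_def)
qed

text \<open>A component with \<open>y\<^sub>k = 0\<close> is lost under \<open>Y\<close>, but nothing is missing: there \<open>x - z\<close> vanishes.\<close>

lemma scale_unscale:
  assumes s0: "s0 \<in> primitive_set net i" and z: "z \<in> carrier_vec (Nx net i)"
    and x: "x \<in> forecast_set net i y z"
  shows "Ymat net i y *\<^sub>v unscale s0 y z x + z = x"
proof -
  have s0c: "s0 \<in> carrier_vec (Nx net i)" using s0 by (simp add: primitive_set_def)
  have xc: "x \<in> carrier_vec (Nx net i)" using x unfolding forecast_set_by_components[OF z] by simp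
  then have xz: "x - z \<in> carrier_vec (Nx net i)" using z by auto
  note uc = unscale_carrier[OF s0c z xc, of y]
  have "Ymat net i y *\<^sub>v unscale s0 y z x = x - z"
  proof (rule eq_by_components)
    fix k assume k: "k < nblk net i"
    show "Pmat net i k *\<^sub>v (Ymat net i y *\<^sub>v unscale s0 y z x) = Pmat net i k *\<^sub>v (x - z)"
      unfolding Ymat_eq_scaling component_scaling[OF k uc] component_unscale[OF s0c z xc k]
      using unscaled_component_zero[OF s0 z x k] carrier_vecD[OF projection_mult_carrier[OF k s0c]]
      by (cases "y $ k = 0") (auto simp: smult_smult_assoc simp del: dim_mult_mat_vec index_mult_mat_vec intro!: eq_vecI)
  qed (use uc xz in \<open>simp_all add: Ymat_eq_scaling\<close>)
  then show ?thesis using vec_add_diff_cancel(2)[OF xc z] by simp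
qed

end


section \<open>Causal maps and policies\<close>

definition causal_map :: "network \<Rightarrow> nat \<Rightarrow> (real vec \<Rightarrow> real vec) \<Rightarrow> bool" where
  "causal_map net j \<phi> \<longleftrightarrow>
     \<phi> \<in> carrier_vec (Nx net j) \<rightarrow> carrier_vec (Nx net j) \<and>
     (\<forall>t\<in>{1..horizon net}. \<forall>v\<in>carrier_vec (Nx net j). \<forall>w\<in>carrier_vec (Nx net j).
        vec_first v (t * nx net j) = vec_first w (t * nx net j) \<longrightarrow>
        vec_first (\<phi> v) (t * nx net j) = vec_first (\<phi> w) (t * nx net j))"

lemma causal_map_comp:
  "causal_map net j \<phi> \<Longrightarrow> causal_map net j \<psi> \<Longrightarrow> causal_map net j (\<lambda>v. \<phi> (\<psi> v))"
  unfolding causal_map_def Pi_iff by meson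

lemma stage_le_Nx: "t \<in> {1..horizon net} \<Longrightarrow> t * nx net j \<le> Nx net j"
  unfolding Nx_def by (intro mult_le_mono1) auto

lemma vec_first_eq_iff:
  "vec_first v n = vec_first w n \<longleftrightarrow> (\<forall>r<n. v $ r = w $ r)"
  by (auto simp: vec_first_def vec_eq_iff)

lemma causal_map_add_const:
  "a \<in> carrier_vec (Nx net j) \<Longrightarrow> causal_map net j (\<lambda>v. v + a)"
  using stage_le_Nx[of _ net j]
  by (fastforce simp: causal_map_def vec_first_eq_iff)

lemma causal_map_diff_const:
  "a \<in> carrier_vec (Nx net j) \<Longrightarrow> causal_map net j (\<lambda>v. v - a)"
  using stage_le_Nx[of _ net j]
  by (fastforce simp: causal_map_def vec_first_eq_iff)

text \<open>The matrix is block lower triangular, so a row belonging to one of the stages \<open>1,\<dots>,t\<close> has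
  only zero entries in the columns of later stages.\<close>

lemma causal_map_mult_mat_vec:
  assumes M: "M \<in> carrier_mat (Nx net j) (Nx net j)"
    and tri: "\<And>r c. r < Nx net j \<Longrightarrow> c < Nx net j \<Longrightarrow> r div nx net j < c div nx net j \<Longrightarrow> M $$ (r, c) = 0"
  shows "causal_map net j (\<lambda>v. M *\<^sub>v v)"
  unfolding causal_map_def
proof (intro conjI ballI impI)
  show "(\<lambda>v. M *\<^sub>v v) \<in> carrier_vec (Nx net j) \<rightarrow> carrier_vec (Nx net j)" using M by auto
  fix t and v w :: "real vec"
  assume t: "t \<in> {1..horizon net}" and v: "v \<in> carrier_vec (Nx net j)" and w: "w \<in> carrier_vec (Nx net j)"
    and eq: "vec_first v (t * nx net j) = vec_first w (t * nx net j)"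
  have "(M *\<^sub>v v) $ r = (M *\<^sub>v w) $ r" if r: "r < t * nx net j" for r
  proof -
    have rN: "r < Nx net j" using r stage_le_Nx[OF t, of j] by simp
    have "M $$ (r, c) * v $ c = M $$ (r, c) * w $ c" if c: "c < Nx net j" for c
    proof (cases "c < t * nx net j")
      case True
      then show ?thesis using eq by (simp add: vec_first_eq_iff)
    next
      case False
      have pos: "nx net j > 0" using r by (cases "nx net j") auto
      have "r div nx net j < t" using r pos by (simp add: less_mult_imp_div_less)
      also have "t \<le> c div nx net j" using False pos by (simp add: less_eq_div_iff_mult_less_eq)
      finally show ?thesis using tri[OF rN c] by simp
    qed
    then show ?thesis unfolding mult_mat_vec_nth[OF M v rN] mult_mat_vec_nth[OF M w rN] by (intro sum.cong) auto
  qed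
  then show "vec_first (M *\<^sub>v v) (t * nx net j) = vec_first (M *\<^sub>v w) (t * nx net j)"
    by (simp add: vec_first_eq_iff)
qed

context network_agent
begin

lemma causal_scaling:
  assumes "causal_projections net"
  shows "causal_map net i (\<lambda>v. scaling w *\<^sub>v v)"
  using assms agent
  by (intro causal_map_mult_mat_vec) (auto simp: scaling_def causal_projections_def intro!: sum.neutral)

lemma causal_scale:
  assumes "causal_projections net" "z \<in> carrier_vec (Nx net i)"
  shows "causal_map net i (\<lambda>s. Ymat net i y *\<^sub>v s + z)"
  unfolding Ymat_eq_scaling
  by (rule causal_map_comp[OF causal_map_add_const causal_scaling]) (use assms in auto)

lemma causal_unscale:
  assumes "causal_projections net" "z \<in> carrier_vec (Nx net i)" "s0 \<in> carrier_vec (Nx net i)"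
  shows "causal_map net i (unscale s0 y z)"
  unfolding unscale_def
  by (rule causal_map_comp[OF causal_map_add_const causal_map_comp[OF causal_scaling causal_map_diff_const]])
     (use assms in auto)

end

definition zero_pad :: "nat \<Rightarrow> real vec \<Rightarrow> real vec" where
  "zero_pad n v = vec n (\<lambda>r. if r < dim_vec v then v $ r else 0)"

text \<open>A policy receives histories, while the translations act on full trajectories. The history is
  therefore extended by zeros, translated and truncated again; for a causal translation the extension
  does not affect the result.\<close>

definition reparametrize :: "network \<Rightarrow> nat \<Rightarrow> (nat \<Rightarrow> real vec \<Rightarrow> real vec) \<Rightarrow> policy \<Rightarrow> policy" where
  "reparametrize net i \<phi> \<Gamma> = (\<lambda>t \<xi> h. \<Gamma> t \<xi>
     (\<lambda>j\<in>nbrs net i. vec_first (\<phi> j (zero_pad (Nx net j) (h j))) (t * nx net j)))"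

lemma reparametrize_in_SC:
  assumes "\<Gamma> \<in> SC net i"
  shows "reparametrize net i \<phi> \<Gamma> \<in> SC net i"
  using assms by (auto simp: SC_def reparametrize_def)

text \<open>The identity that makes the two problems interchangeable: by causality, translating each
  history gives the same policy arguments as translating the whole trajectory once.\<close>

lemma apply_policy_reparametrize:
  assumes \<phi>: "\<And>j. j \<in> nbrs net i \<Longrightarrow> causal_map net j (\<phi> j)"
    and h: "\<And>j. j \<in> nbrs net i \<Longrightarrow> h j \<in> carrier_vec (Nx net j)"
  shows "apply_policy net i (reparametrize net i \<phi> \<Gamma>) \<xi> h
       = apply_policy net i \<Gamma> \<xi> (\<lambda>j\<in>nbrs net i. \<phi> j (h j))"
proof -
  have "vec_first (\<phi> j (zero_pad (Nx net j) (vec_first (h j) (t * nx net j)))) (t * nx net j)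
      = vec_first (\<phi> j (h j)) (t * nx net j)"
    if j: "j \<in> nbrs net i" and t: "t \<in> {1..horizon net}" for j t
  proof -
    have "vec_first (zero_pad (Nx net j) (vec_first (h j) (t * nx net j))) (t * nx net j)
        = vec_first (h j) (t * nx net j)"
      using stage_le_Nx[OF t, of j] unfolding vec_first_eq_iff by (auto simp: zero_pad_def vec_first_def)
    moreover have "zero_pad (Nx net j) (vec_first (h j) (t * nx net j)) \<in> carrier_vec (Nx net j)"
      by (simp add: zero_pad_def)
    ultimately show ?thesis using \<phi>[OF j] h[OF j] t unfolding causal_map_def by blast
  qed
  then have args: "(\<lambda>j\<in>nbrs net i. vec_first (\<phi> j (zero_pad (Nx net j)
            ((\<lambda>j\<in>nbrs net i. vec_first (h j) (t * nx net j)) j))) (t * nx net j))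
        = (\<lambda>j\<in>nbrs net i. vec_first ((\<lambda>j\<in>nbrs net i. \<phi> j (h j)) j) (t * nx net j))"
    if "t \<in> {1..horizon net}" for t
    using that by (intro restrict_ext) simp
  show ?thesis
    unfolding apply_policy_def reparametrize_def
    by (intro arg_cong[where f = stack] map_cong[OF refl], subst args) auto
qed


section \<open>The transfer between the two problems\<close>

locale causal_network =
  fixes net :: network
  assumes valid: "valid_network net"
    and nonempty: "\<And>i. i \<in> {1..agents net} \<Longrightarrow> primitive_set net i \<noteq> {}"
    and causal: "causal_projections net"
begin

definition base_point :: "nat \<Rightarrow> real vec" where
  "base_point i = (SOME s. s \<in> primitive_set net i)"

definition to_forecast :: "(nat \<Rightarrow> real vec) \<Rightarrow> (nat \<Rightarrow> real vec) \<Rightarrow> nat \<Rightarrow> real vec \<Rightarrow> real vec" where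
  "to_forecast y z j = (\<lambda>s. Ymat net j (y j) *\<^sub>v s + z j)"

definition to_primitive :: "(nat \<Rightarrow> real vec) \<Rightarrow> (nat \<Rightarrow> real vec) \<Rightarrow> nat \<Rightarrow> real vec \<Rightarrow> real vec" where
  "to_primitive y z j = network_agent.unscale net j (base_point j) (y j) (z j)"

definition zeta_policies :: "decision \<Rightarrow> nat \<Rightarrow> policy" where
  "zeta_policies = (\<lambda>(\<Gamma>, y, z) i. reparametrize net i (to_primitive y z) (\<Gamma> i))"

definition s_policies :: "decision \<Rightarrow> nat \<Rightarrow> policy" where
  "s_policies = (\<lambda>(\<Psi>, y, z) i. reparametrize net i (to_forecast y z) (\<Psi> i))"

lemma network_agent: "j \<in> {1..agents net} \<Longrightarrow> network_agent net j"
  using valid by unfold_locales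

lemma nbr_agent: "i \<in> {1..agents net} \<Longrightarrow> j \<in> nbrs net i \<Longrightarrow> j \<in> {1..agents net}"
  using valid unfolding valid_network_def by blast

lemma base_point: "i \<in> {1..agents net} \<Longrightarrow> base_point i \<in> primitive_set net i"
  using nonempty[of i] unfolding base_point_def by (meson ex_in_conv someI)

context
  fixes y z :: "nat \<Rightarrow> real vec" and i :: nat
  assumes params: "\<forall>j\<in>{1..agents net}. admissible_params net j (y j) (z j)"
    and i: "i \<in> {1..agents net}"
begin

lemma nbr_params:
  assumes "j \<in> nbrs net i"
  shows "network_agent net j" "0\<^sub>v (nblk net j) \<le> y j" "z j \<in> carrier_vec (Nx net j)"
    "base_point j \<in> primitive_set net j" "base_point j \<in> carrier_vec (Nx net j)"
  using nbr_agent[OF i assms] network_agent params base_point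
  by (auto simp: admissible_params_def primitive_set_def)

lemma nbr_affine_eq: "nbr_affine net i y z s = (\<lambda>j\<in>nbrs net i. to_forecast y z j (s j))"
  by (simp add: nbr_affine_def to_forecast_def)

lemma nbr_affine_in_forecast:
  assumes "s \<in> nbr_primitive net i"
  shows "nbr_affine net i y z s \<in> nbr_forecast net i y z"
  using assms network_agent.scaled_primitive_in_forecast[OF nbr_params(1,2,3)]
  by (auto simp: nbr_affine_def nbr_forecast_def nbr_primitive_def PiE_iff)

lemma to_primitive_in_primitive:
  assumes "\<zeta> \<in> nbr_forecast net i y z"
  shows "(\<lambda>j\<in>nbrs net i. to_primitive y z j (\<zeta> j)) \<in> nbr_primitive net i"
  using assms network_agent.unscale_in_primitive[OF nbr_params(1,4,3,2)]
  by (auto simp: to_primitive_def nbr_forecast_def nbr_primitive_def PiE_iff)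

lemma nbr_affine_to_primitive:
  assumes \<zeta>: "\<zeta> \<in> nbr_forecast net i y z"
  shows "nbr_affine net i y z (\<lambda>j\<in>nbrs net i. to_primitive y z j (\<zeta> j)) = \<zeta>"
proof
  fix j
  show "nbr_affine net i y z (\<lambda>j\<in>nbrs net i. to_primitive y z j (\<zeta> j)) j = \<zeta> j"
  proof (cases "j \<in> nbrs net i")
    case True
    then show ?thesis
      using \<zeta> network_agent.scale_unscale[OF nbr_params(1,4,3), OF True True True, of "\<zeta> j"]
      by (auto simp: nbr_affine_def to_primitive_def nbr_forecast_def)
  next
    case False
    then show ?thesis using \<zeta> by (auto simp: nbr_affine_def nbr_forecast_def PiE_iff extensional_def)
  qed
qed

lemma apply_zeta_policy:
  assumes "\<zeta> \<in> nbr_forecast net i y z"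
  shows "apply_policy net i (zeta_policies (\<Gamma>, y, z) i) \<xi> \<zeta>
       = apply_policy net i (\<Gamma> i) \<xi> (\<lambda>j\<in>nbrs net i. to_primitive y z j (\<zeta> j))"
  unfolding zeta_policies_def prod.case
proof (rule apply_policy_reparametrize)
  fix j assume j: "j \<in> nbrs net i"
  show "causal_map net j (to_primitive y z j)" unfolding to_primitive_def
    using network_agent.causal_unscale[OF nbr_params(1) causal nbr_params(3,5)] j by auto
  show "\<zeta> j \<in> carrier_vec (Nx net j)"
    using assms j by (auto simp: nbr_forecast_def forecast_set_def)
qed

lemma apply_s_policy:
  assumes "s \<in> nbr_primitive net i"
  shows "apply_policy net i (s_policies (\<Psi>, y, z) i) \<xi> s
       = apply_policy net i (\<Psi> i) \<xi> (nbr_affine net i y z s)"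
  unfolding s_policies_def prod.case nbr_affine_eq
proof (rule apply_policy_reparametrize)
  fix j assume j: "j \<in> nbrs net i"
  show "causal_map net j (to_forecast y z j)" unfolding to_forecast_def
    using network_agent.causal_scale[OF nbr_params(1) causal nbr_params(3)] j by auto
  show "s j \<in> carrier_vec (Nx net j)"
    using assms j by (auto simp: nbr_primitive_def primitive_set_def)
qed

end

lemma feasible_zeta_policies:
  assumes feas: "feasible_s net (\<Gamma>, y, z)"
  shows "feasible_zeta net (zeta_policies (\<Gamma>, y, z), y, z)"
proof -
  have params: "\<forall>j\<in>{1..agents net}. admissible_params net j (y j) (z j)"
    using feas by simp
  show ?thesis
    unfolding feasible_zeta.simps Let_def
  proof (intro ballI conjI)
    fix i assume i: "i \<in> {1..agents net}"
    show "zeta_policies (\<Gamma>, y, z) i \<in> SC net i"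
      using feas i by (auto simp: zeta_policies_def intro!: reparametrize_in_SC)
    show "admissible_params net i (y i) (z i)" using params i by blast
    fix \<xi> \<zeta> assume \<xi>: "\<xi> \<in> Xi net i" and \<zeta>: "\<zeta> \<in> nbr_forecast net i y z"
    note s = to_primitive_in_primitive[OF params i \<zeta>]
    have "let u = apply_policy net i (\<Gamma> i) \<xi> (\<lambda>j\<in>nbrs net i. to_primitive y z j (\<zeta> j));
        \<zeta> = nbr_affine net i y z (\<lambda>j\<in>nbrs net i. to_primitive y z j (\<zeta> j)); x = dynamics net i \<zeta> u \<xi>
      in (x, u) \<in> op_constraints net i \<and> x \<in> forecast_set net i (y i) (z i)"
      using feas i \<xi> s unfolding feasible_s.simps by blast
    then show "(dynamics net i \<zeta> (apply_policy net i (zeta_policies (\<Gamma>, y, z) i) \<xi> \<zeta>) \<xi>,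
          apply_policy net i (zeta_policies (\<Gamma>, y, z) i) \<xi> \<zeta>) \<in> op_constraints net i"
        "dynamics net i \<zeta> (apply_policy net i (zeta_policies (\<Gamma>, y, z) i) \<xi> \<zeta>) \<xi>
          \<in> forecast_set net i (y i) (z i)"
      unfolding apply_zeta_policy[OF params i \<zeta>] nbr_affine_to_primitive[OF params i \<zeta>] Let_def
      by auto
  qed
qed

lemma feasible_s_policies:
  assumes feas: "feasible_zeta net (\<Psi>, y, z)"
  shows "feasible_s net (s_policies (\<Psi>, y, z), y, z)"
proof -
  have params: "\<forall>j\<in>{1..agents net}. admissible_params net j (y j) (z j)"
    using feas by simp
  show ?thesis
    unfolding feasible_s.simps Let_def
  proof (intro ballI conjI)
    fix i assume i: "i \<in> {1..agents net}"
    show "s_policies (\<Psi>, y, z) i \<in> SC net i"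
      using feas i by (auto simp: s_policies_def intro!: reparametrize_in_SC)
    show "admissible_params net i (y i) (z i)" using params i by blast
    fix \<xi> s assume \<xi>: "\<xi> \<in> Xi net i" and s: "s \<in> nbr_primitive net i"
    note \<zeta> = nbr_affine_in_forecast[OF params i s]
    show "(dynamics net i (nbr_affine net i y z s) (apply_policy net i (s_policies (\<Psi>, y, z) i) \<xi> s) \<xi>,
          apply_policy net i (s_policies (\<Psi>, y, z) i) \<xi> s) \<in> op_constraints net i"
        "dynamics net i (nbr_affine net i y z s) (apply_policy net i (s_policies (\<Psi>, y, z) i) \<xi> s) \<xi>
          \<in> forecast_set net i (y i) (z i)"
      unfolding apply_s_policy[OF params i s]
      using feas i \<xi> \<zeta> unfolding feasible_zeta.simps Let_def by blast+
  qed
qed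

text \<open>Each scenario \<open>(\<xi>, \<zeta>)\<close> has the cost of the scenario with \<open>s\<close> the translation of \<open>\<zeta>\<close>. Equality may
  fail, because these \<open>s\<close> do not exhaust the primitive set when some \<open>y\<^sub>k = 0\<close>.\<close>

lemma objective_zeta_policies:
  assumes params: "\<forall>j\<in>{1..agents net}. admissible_params net j (y j) (z j)"
  shows "objective_zeta net (zeta_policies (\<Gamma>, y, z), y, z) \<le> objective_s net (\<Gamma>, y, z)"
  unfolding objective_zeta.simps objective_s.simps
proof (intro sum_mono SUP_mono)
  fix i p assume i: "i \<in> {1..agents net}" and p: "p \<in> Xi net i \<times> nbr_forecast net i y z"
  obtain \<xi> \<zeta> where p_eq: "p = (\<xi>, \<zeta>)" by (cases p)
  then have \<zeta>: "\<zeta> \<in> nbr_forecast net i y z" and \<xi>: "\<xi> \<in> Xi net i" using p by auto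
  show "\<exists>q\<in>Xi net i \<times> nbr_primitive net i.
      (case p of (\<xi>, \<zeta>) \<Rightarrow> let u = apply_policy net i (zeta_policies (\<Gamma>, y, z) i) \<xi> \<zeta>;
          x = dynamics net i \<zeta> u \<xi> in ereal (cost net i x u))
    \<le> (case q of (\<xi>, s) \<Rightarrow> let u = apply_policy net i (\<Gamma> i) \<xi> s; \<zeta> = nbr_affine net i y z s;
          x = dynamics net i \<zeta> u \<xi> in ereal (cost net i x u))"
    using \<xi> to_primitive_in_primitive[OF params i \<zeta>]
    by (intro bexI[of _ "(\<xi>, \<lambda>j\<in>nbrs net i. to_primitive y z j (\<zeta> j))"])
       (auto simp: p_eq apply_zeta_policy[OF params i \<zeta>] nbr_affine_to_primitive[OF params i \<zeta>] Let_def)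
qed

text \<open>Each \<open>s\<close> has the cost of its image, and every \<open>\<zeta>\<close> is the image of some \<open>s\<close>, namely of its
  translation.\<close>

lemma objective_s_policies:
  assumes params: "\<forall>j\<in>{1..agents net}. admissible_params net j (y j) (z j)"
  shows "objective_s net (s_policies (\<Psi>, y, z), y, z) = objective_zeta net (\<Psi>, y, z)"
  unfolding objective_zeta.simps objective_s.simps
proof (intro sum.cong refl SUP_eq)
  fix i p assume i: "i \<in> {1..agents net}"
  {
    assume p: "p \<in> Xi net i \<times> nbr_primitive net i"
    obtain \<xi> s where p_eq: "p = (\<xi>, s)" by (cases p)
    then have s: "s \<in> nbr_primitive net i" and \<xi>: "\<xi> \<in> Xi net i" using p by auto
    show "\<exists>q\<in>Xi net i \<times> nbr_forecast net i y z.
        (case p of (\<xi>, s) \<Rightarrow> let u = apply_policy net i (s_policies (\<Psi>, y, z) i) \<xi> s;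
            \<zeta> = nbr_affine net i y z s; x = dynamics net i \<zeta> u \<xi> in ereal (cost net i x u))
      \<le> (case q of (\<xi>, \<zeta>) \<Rightarrow> let u = apply_policy net i (\<Psi> i) \<xi> \<zeta>;
            x = dynamics net i \<zeta> u \<xi> in ereal (cost net i x u))"
      using \<xi> nbr_affine_in_forecast[OF params i s]
      by (intro bexI[of _ "(\<xi>, nbr_affine net i y z s)"])
         (auto simp: p_eq apply_s_policy[OF params i s] Let_def)
  next
    assume p: "p \<in> Xi net i \<times> nbr_forecast net i y z"
    obtain \<xi> \<zeta> where p_eq: "p = (\<xi>, \<zeta>)" by (cases p)
    then have \<zeta>: "\<zeta> \<in> nbr_forecast net i y z" and \<xi>: "\<xi> \<in> Xi net i" using p by auto
    note s = to_primitive_in_primitive[OF params i \<zeta>]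
    show "\<exists>q\<in>Xi net i \<times> nbr_primitive net i.
        (case p of (\<xi>, \<zeta>) \<Rightarrow> let u = apply_policy net i (\<Psi> i) \<xi> \<zeta>;
            x = dynamics net i \<zeta> u \<xi> in ereal (cost net i x u))
      \<le> (case q of (\<xi>, s) \<Rightarrow> let u = apply_policy net i (s_policies (\<Psi>, y, z) i) \<xi> s;
            \<zeta> = nbr_affine net i y z s; x = dynamics net i \<zeta> u \<xi> in ereal (cost net i x u))"
      using \<xi> s
      by (intro bexI[of _ "(\<xi>, \<lambda>j\<in>nbrs net i. to_primitive y z j (\<zeta> j))"])
         (auto simp: p_eq apply_s_policy[OF params i s] nbr_affine_to_primitive[OF params i \<zeta>] Let_def)
  }
qed

lemma optimal_values_eq: "optimal_value_s net = optimal_value_zeta net"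
proof (rule antisym)
  show "optimal_value_s net \<le> optimal_value_zeta net"
    unfolding optimal_value_s_def optimal_value_zeta_def
  proof (rule INF_mono)
    fix d assume d: "d \<in> {d. feasible_zeta net d}"
    obtain \<Psi> y z where "d = (\<Psi>, y, z)" by (cases d)
    then show "\<exists>e\<in>{d. feasible_s net d}. objective_s net e \<le> objective_zeta net d"
      using d feasible_s_policies[of \<Psi> y z] objective_s_policies[of y z \<Psi>]
      by (intro bexI[of _ "(s_policies (\<Psi>, y, z), y, z)"]) auto
  qed
  show "optimal_value_zeta net \<le> optimal_value_s net"
    unfolding optimal_value_s_def optimal_value_zeta_def
  proof (rule INF_mono)
    fix d assume d: "d \<in> {d. feasible_s net d}"
    obtain \<Gamma> y z where "d = (\<Gamma>, y, z)" by (cases d)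
    then show "\<exists>e\<in>{d. feasible_zeta net d}. objective_zeta net e \<le> objective_s net d"
      using d feasible_zeta_policies[of \<Gamma> y z] objective_zeta_policies[of y z \<Gamma>]
      by (intro bexI[of _ "(zeta_policies (\<Gamma>, y, z), y, z)"]) auto
  qed
qed

end

theorem theorem5:
  fixes net :: network
  assumes valid: "valid_network net"
    and nonempty: "\<And>i. i \<in> {1..agents net} \<Longrightarrow> primitive_set net i \<noteq> {}"
    and causal: "causal_projections net"
  shows "(\<exists>\<Phi> :: decision \<Rightarrow> nat \<Rightarrow> policy. \<forall>\<Gamma> y z. feasible_s net (\<Gamma>, y, z) \<longrightarrow>
            feasible_zeta net (\<Phi> (\<Gamma>, y, z), y, z) \<and>
            objective_zeta net (\<Phi> (\<Gamma>, y, z), y, z) \<le> objective_s net (\<Gamma>, y, z)) \<and>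
         (\<exists>\<Theta> :: decision \<Rightarrow> nat \<Rightarrow> policy. \<forall>\<Psi> y z. feasible_zeta net (\<Psi>, y, z) \<longrightarrow>
            feasible_s net (\<Theta> (\<Psi>, y, z), y, z) \<and>
            objective_s net (\<Theta> (\<Psi>, y, z), y, z) = objective_zeta net (\<Psi>, y, z)) \<and>
         optimal_value_s net = optimal_value_zeta net"
proof -
  interpret causal_network net
    using assms by unfold_locales
  show ?thesis
  proof (intro conjI)
    show "\<exists>\<Phi> :: decision \<Rightarrow> nat \<Rightarrow> policy. \<forall>\<Gamma> y z. feasible_s net (\<Gamma>, y, z) \<longrightarrow>
        feasible_zeta net (\<Phi> (\<Gamma>, y, z), y, z) \<and>
        objective_zeta net (\<Phi> (\<Gamma>, y, z), y, z) \<le> objective_s net (\<Gamma>, y, z)"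
      by (intro exI[of _ zeta_policies] allI impI conjI feasible_zeta_policies objective_zeta_policies) auto
    show "\<exists>\<Theta> :: decision \<Rightarrow> nat \<Rightarrow> policy. \<forall>\<Psi> y z. feasible_zeta net (\<Psi>, y, z) \<longrightarrow>
        feasible_s net (\<Theta> (\<Psi>, y, z), y, z) \<and>
        objective_s net (\<Theta> (\<Psi>, y, z), y, z) = objective_zeta net (\<Psi>, y, z)"
      by (intro exI[of _ s_policies] allI impI conjI feasible_s_policies objective_s_policies) auto
    show "optimal_value_s net = optimal_value_zeta net" by (rule optimal_values_eq)
  qed
qed

end
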